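(* Consider Misère Connect $k$ on a board with even height $h$ and finite width $w$, with $w\ge k$. If P2 plays the take-even strategy, then, whatever P1 does, P2 always has a move prescribed by the strategy available, and P1 is eventually forced to connect $k$ (before P2 does). In particular, P2 has a guaranteed win.
   Context: Misère Connect $k$ is played on a grid with $w$ columns and $h$ rows ($w,h$ positive integers, $k\ge 2$). Player 1 (P1, pieces X) and Player 2 (P2, pieces O) alternate turns, P1 first. On each turn the player selects a non-full column and their piece occupies the lowest empty cell of that column; a column is full after $h$ plays. A player connects $k$ when $k$ of their pieces occupy $k$ consecutive cells in a horizontal, vertical, or diagonal (either direction) line. The first player to connect $k$ loses (the other wins) and the game ends. If the board fills with no player having connected $k$, the game is a draw. Rows are numbered $1,2,\dots,h$ from the bottom. The take-even strategy for P2 is: on every turn, play in an even-numbered row (equivalently, directly on top of P1's most recent piece). *)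

theory Defs
  imports Main
begin

datatype player = P1 | P2

fun opponent :: "player \<Rightarrow> player" where
  "opponent P1 = P2"
| "opponent P2 = P1"

text \<open>
  A position is the chronological list of the columns played so far. Columns are numbered
  \<open>1, \<dots>, w\<close>, and rows \<open>1, \<dots>, h\<close> from the bottom; a cell is a pair (column, row).
\<close>

definition to_move :: "nat list \<Rightarrow> player" where
  "to_move ms = (if even (length ms) then P1 else P2)"

definition next_row :: "nat list \<Rightarrow> nat \<Rightarrow> nat" where
  "next_row ms c = Suc (count_list ms c)"

definition legal_move :: "nat \<Rightarrow> nat \<Rightarrow> nat list \<Rightarrow> nat \<Rightarrow> bool" where
  "legal_move h w ms c \<longleftrightarrow> c \<in> {1..w} \<and> next_row ms c \<le> h"

definition pieces :: "nat list \<Rightarrow> player \<Rightarrow> (nat \<times> nat) set" where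
  "pieces ms p =
     {(ms ! i, next_row (take i ms) (ms ! i)) | i. i < length ms \<and> to_move (take i ms) = p}"

text \<open>
  The last clause is the falling diagonal, listed from its right end upwards to the left so that
  no truncated subtraction occurs for \<open>j < k\<close>.
\<close>

definition is_line :: "nat \<Rightarrow> (nat \<times> nat) set \<Rightarrow> bool" where
  "is_line k L \<longleftrightarrow> (\<exists>c r.
      L = (\<lambda>j. (c + j, r)) ` {..<k} \<or>
      L = (\<lambda>j. (c, r + j)) ` {..<k} \<or>
      L = (\<lambda>j. (c + j, r + j)) ` {..<k} \<or>
      L = (\<lambda>j. (c + (k - 1 - j), r + j)) ` {..<k})"

definition connects :: "nat \<Rightarrow> nat list \<Rightarrow> player \<Rightarrow> bool" where
  "connects k ms p \<longleftrightarrow> (\<exists>L. is_line k L \<and> L \<subseteq> pieces ms p)"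

definition game_over :: "nat \<Rightarrow> nat \<Rightarrow> nat \<Rightarrow> nat list \<Rightarrow> bool" where
  "game_over k h w ms \<longleftrightarrow> (\<exists>p. connects k ms p) \<or> \<not> (\<exists>c. legal_move h w ms c)"

inductive play :: "nat \<Rightarrow> nat \<Rightarrow> nat \<Rightarrow> nat list \<Rightarrow> bool" for k h w :: nat where
  start: "play k h w []"
| move: "play k h w ms \<Longrightarrow> \<not> game_over k h w ms \<Longrightarrow> legal_move h w ms c \<Longrightarrow> play k h w (ms @ [c])"

text \<open>
  A play stops as soon as somebody has connected \<open>k\<close>, so in a play a player who has connected
  while the other has not is the first to connect, and hence the loser.
\<close>

definition wins :: "nat \<Rightarrow> nat list \<Rightarrow> player \<Rightarrow> bool" where
  "wins k ms p \<longleftrightarrow> connects k ms (opponent p) \<and> \<not> connects k ms p"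

text \<open>
  A strategy maps each position to the set of columns it prescribes there; a deterministic
  strategy prescribes a singleton. Legality is not built into the prescription, so that the
  existence of a legal prescribed move is something to be proved.
\<close>

type_synonym strategy = "nat list \<Rightarrow> nat set"

definition play_following ::
  "nat \<Rightarrow> nat \<Rightarrow> nat \<Rightarrow> player \<Rightarrow> strategy \<Rightarrow> nat list \<Rightarrow> bool" where
  "play_following k h w p S ms \<longleftrightarrow> play k h w ms \<and>
     (\<forall>i < length ms. to_move (take i ms) = p \<longrightarrow> ms ! i \<in> S (take i ms))"

definition always_available :: "nat \<Rightarrow> nat \<Rightarrow> nat \<Rightarrow> player \<Rightarrow> strategy \<Rightarrow> bool" where
  "always_available k h w p S \<longleftrightarrow>
     (\<forall>ms. play_following k h w p S ms \<and> \<not> game_over k h w ms \<and> to_move ms = p \<longrightarrow>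
        (\<exists>c \<in> S ms. legal_move h w ms c))"

text \<open>
  However the opponent of \<open>p\<close> plays against \<open>S\<close>, the game ends after finitely many moves, in a
  position satisfying \<open>Q\<close>.
\<close>

definition inevitable ::
  "nat \<Rightarrow> nat \<Rightarrow> nat \<Rightarrow> player \<Rightarrow> strategy \<Rightarrow> (nat list \<Rightarrow> bool) \<Rightarrow> bool" where
  "inevitable k h w p S Q \<longleftrightarrow>
     \<not> (\<exists>s :: nat \<Rightarrow> nat. \<forall>n. play_following k h w p S (map s [0..<n])) \<and>
     (\<forall>ms. play_following k h w p S ms \<and> game_over k h w ms \<longrightarrow> Q ms)"

definition guaranteed_win :: "nat \<Rightarrow> nat \<Rightarrow> nat \<Rightarrow> player \<Rightarrow> bool" where
  "guaranteed_win k h w p \<longleftrightarrow>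
     (\<exists>\<sigma> :: nat list \<Rightarrow> nat.
        always_available k h w p (\<lambda>ms. {\<sigma> ms}) \<and>
        inevitable k h w p (\<lambda>ms. {\<sigma> ms}) (\<lambda>ms. wins k ms p))"

definition take_even :: strategy where
  "take_even ms = {c. even (next_row ms c)}"

end

theory Submission
  imports Defs
begin

text \<open>
  As long as P2 takes even, every column has even height when P1 is to move. Hence P1's pieces
  always land in odd rows and P2's in even rows (\<open>parity_invariant\<close>). Whoever connects along a
  column or a diagonal owns cells in two adjacent rows, so P2 can only connect inside one even row;
  but each of P2's pieces there lies on a piece of P1, and these pieces form a line of P1
  (\<open>connects_row_below\<close>). That line was complete before P2's last move, so the game had already
  ended with P1's loss, and P2 never connects at all (\<open>P2_never_connects\<close>). A draw is impossible
  too, because on a full board the whole bottom row belongs to P1 (\<open>full_board_connects_P1\<close>).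
  Since the board is finite, the game must end, and it can only end with P1 connecting.

  A reply is always available because the column that P1 has just played in has odd height,
  hence is not full when \<open>h\<close> is even.
\<close>

section \<open>Plays that follow a strategy\<close>

lemma play_snoc_iff:
  "play k h w (ms @ [c]) \<longleftrightarrow> play k h w ms \<and> \<not> game_over k h w ms \<and> legal_move h w ms c"
  by (subst play.simps) auto

lemma play_following_Nil: "play_following k h w p S []"
  by (simp add: play_following_def play.start)

lemma play_following_snoc_iff:
  "play_following k h w p S (ms @ [c]) \<longleftrightarrow>
     play_following k h w p S ms \<and> \<not> game_over k h w ms \<and> legal_move h w ms c \<and>
     (to_move ms = p \<longrightarrow> c \<in> S ms)"
  by (auto simp: play_following_def play_snoc_iff less_Suc_eq nth_append)

lemma play_following_induct [consumes 1, case_names Nil snoc]: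
  assumes "play_following k h w p S ms"
    and "P []"
    and "\<And>ms c. play_following k h w p S ms \<Longrightarrow> \<not> game_over k h w ms \<Longrightarrow> legal_move h w ms c \<Longrightarrow>
           (to_move ms = p \<Longrightarrow> c \<in> S ms) \<Longrightarrow> P ms \<Longrightarrow> P (ms @ [c])"
  shows "P ms"
  using assms(1)
proof (induction ms rule: rev_induct)
  case Nil
  show ?case by (fact assms(2))
next
  case (snoc c ms)
  then show ?case
    using assms(3) by (simp add: play_following_snoc_iff)
qed

lemma play_following_within_board:
  assumes "play_following k h w p S ms"
  shows "set ms \<subseteq> {1..w}" and "count_list ms c \<le> h"
  using assms
  by (induction rule: play_following_induct) (auto simp: legal_move_def next_row_def)

lemma length_play_following_le:
  assumes "play_following k h w p S ms"
  shows "length ms \<le> w * h"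
proof -
  have "length ms = (\<Sum>c\<in>set ms. count_list ms c)"
    by (simp add: sum_count_set)
  also have "\<dots> \<le> card (set ms) * h"
    using play_following_within_board(2)[OF assms]
    by (metis (no_types, lifting) of_nat_id sum_bounded_above)
  also have "card (set ms) \<le> card {1..w}"
    using play_following_within_board(1)[OF assms] by (intro card_mono) auto
  finally show ?thesis by simp
qed

lemma no_infinite_play_following:
  "\<not> (\<exists>s :: nat \<Rightarrow> nat. \<forall>n. play_following k h w p S (map s [0..<n]))"
proof
  assume "\<exists>s :: nat \<Rightarrow> nat. \<forall>n. play_following k h w p S (map s [0..<n])"
  then obtain s where "play_following k h w p S (map s [0..<Suc (w * h)])"
    by blast
  from length_play_following_le[OF this] show False
    by simp
qed

text \<open>
  Any choice among the legal prescribed moves makes a strategy deterministic; the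
  deterministic plays are then plays of the original strategy, so everything inevitable under it
  remains so. Availability under the original strategy is what guarantees that there is a move to choose.
\<close>

lemma deterministic_refinement:
  assumes available: "always_available k h w p S"
  obtains \<sigma> where "always_available k h w p (\<lambda>ms. {\<sigma> ms})"
    and "\<And>Q. inevitable k h w p S Q \<Longrightarrow> inevitable k h w p (\<lambda>ms. {\<sigma> ms}) Q"
proof -
  define \<sigma> where "\<sigma> ms = (SOME c. c \<in> S ms \<and> legal_move h w ms c)" for ms
  have \<sigma>: "\<sigma> ms \<in> S ms \<and> legal_move h w ms (\<sigma> ms)"
    if "play_following k h w p S ms" "\<not> game_over k h w ms" "to_move ms = p" for ms
  proof -
    have "\<exists>c. c \<in> S ms \<and> legal_move h w ms c"
      using available that by (auto simp: always_available_def)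
    then show ?thesis
      unfolding \<sigma>_def by (rule someI_ex)
  qed
  have refines: "play_following k h w p S ms"
    if "play_following k h w p (\<lambda>ms. {\<sigma> ms}) ms" for ms
    using that
  proof (induction rule: play_following_induct)
    case Nil
    show ?case by (rule play_following_Nil)
  next
    case (snoc ms c)
    then show ?case
      using \<sigma>[of ms] by (auto simp: play_following_snoc_iff)
  qed
  show thesis
  proof (rule that)
    show "always_available k h w p (\<lambda>ms. {\<sigma> ms})"
      using \<sigma> refines by (auto simp: always_available_def)
    show "inevitable k h w p (\<lambda>ms. {\<sigma> ms}) Q" if "inevitable k h w p S Q" for Q
      using that refines no_infinite_play_following unfolding inevitable_def by blast
  qed
qed

section \<open>Rows and parity\<close>

lemma to_move_snoc: "to_move (ms @ [c]) = opponent (to_move ms)"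
  by (simp add: to_move_def)

lemma pieces_snoc:
  "pieces (ms @ [c]) p =
     (if to_move ms = p then insert (c, next_row ms c) (pieces ms p) else pieces ms p)"
proof -
  let ?cell = "\<lambda>ms i. (ms ! i, next_row (take i ms) (ms ! i))"
  have pieces_image: "pieces ms p = ?cell ms ` {i \<in> {..<length ms}. to_move (take i ms) = p}" for ms
    by (auto simp: pieces_def)
  have "{i \<in> {..<length (ms @ [c])}. to_move (take i (ms @ [c])) = p} =
      {i \<in> {..<length ms}. to_move (take i ms) = p} \<union> (if to_move ms = p then {length ms} else {})"
    by (auto simp: less_Suc_eq)
  moreover have "?cell (ms @ [c]) ` {i \<in> {..<length ms}. to_move (take i ms) = p} = pieces ms p"
    unfolding pieces_image by (intro image_cong) (auto simp: nth_append)
  ultimately show ?thesis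
    unfolding pieces_image[of "ms @ [c]"] image_Un by simp
qed

text \<open>
  The two parts support each other: the column heights determine the row of the next piece, and
  P2's reply in an even row must go to the only column of odd height, which makes all heights
  even again.
\<close>

lemma parity_invariant:
  assumes "play_following k h w P2 take_even ms"
  shows "{c. odd (count_list ms c)} = (if to_move ms = P1 then {} else {last ms})"
    and "pieces ms p = {(c, r). 1 \<le> r \<and> r \<le> count_list ms c \<and> (odd r \<longleftrightarrow> p = P1)}"
proof -
  have "{c. odd (count_list ms c)} = (if to_move ms = P1 then {} else {last ms}) \<and>
        (\<forall>p. pieces ms p = {(c, r). 1 \<le> r \<and> r \<le> count_list ms c \<and> (odd r \<longleftrightarrow> p = P1)})"
    using assms
  proof (induction rule: play_following_induct)
    case Nil
    show ?case by (auto simp: to_move_def pieces_def)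
  next
    case (snoc ms c)
    have even_columns: "even (count_list ms d) \<longleftrightarrow> to_move ms = P1 \<or> d \<noteq> last ms" for d
      using snoc.IH by (cases "to_move ms") (auto simp: set_eq_iff)
    have next_row_parity: "odd (next_row ms c) \<longleftrightarrow> to_move ms = P1"
      using snoc.hyps even_columns[of c]
      by (cases "to_move ms") (auto simp: next_row_def take_even_def)
    have "{d. odd (count_list (ms @ [c]) d)} = (if to_move (ms @ [c]) = P1 then {} else {c})"
      using even_columns next_row_parity
      by (cases "to_move ms") (auto simp: to_move_snoc next_row_def)
    moreover have "pieces (ms @ [c]) p =
        {(d, r). 1 \<le> r \<and> r \<le> count_list (ms @ [c]) d \<and> (odd r \<longleftrightarrow> p = P1)}" for p
    proof -
      have mover: "to_move ms = p \<longleftrightarrow> (odd (next_row ms c) \<longleftrightarrow> p = P1)"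
        using next_row_parity by (cases p; cases "to_move ms") auto
      show ?thesis
      proof (intro set_eqI, clarify)
        fix d r
        have "(d, r) \<in> pieces ms p \<longleftrightarrow> 1 \<le> r \<and> r \<le> count_list ms d \<and> (odd r \<longleftrightarrow> p = P1)"
          using snoc.IH by simp
        then show "(d, r) \<in> pieces (ms @ [c]) p \<longleftrightarrow>
            (d, r) \<in> {(d, r). 1 \<le> r \<and> r \<le> count_list (ms @ [c]) d \<and> (odd r \<longleftrightarrow> p = P1)}"
          using mover by (cases "d = c"; cases "r = next_row ms c") (auto simp: pieces_snoc next_row_def le_Suc_eq)
      qed
    qed
    ultimately show ?case by simp
  qed
  then show "{c. odd (count_list ms c)} = (if to_move ms = P1 then {} else {last ms})"
    and "pieces ms p = {(c, r). 1 \<le> r \<and> r \<le> count_list ms c \<and> (odd r \<longleftrightarrow> p = P1)}"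
    by blast+
qed

lemma take_even_always_available:
  assumes "even h"
  shows "always_available k h w P2 take_even"
  unfolding always_available_def
proof (intro allI impI, elim conjE)
  fix ms
  assume follows: "play_following k h w P2 take_even ms" and "to_move ms = P2"
  then have odd_last: "odd (count_list ms (last ms))"
    using parity_invariant(1)[OF follows] by (auto simp: set_eq_iff)
  moreover have "count_list ms (last ms) \<le> h"
    by (rule play_following_within_board(2)[OF follows])
  ultimately have "next_row ms (last ms) \<le> h"
    using \<open>even h\<close> by (metis Suc_leI next_row_def order_le_less)
  moreover have "last ms \<in> {1..w}"
    using play_following_within_board(1)[OF follows] odd_last last_in_set[of ms] by fastforce
  ultimately show "\<exists>c \<in> take_even ms. legal_move h w ms c"
    using odd_last by (intro bexI[of _ "last ms"]) (auto simp: legal_move_def take_even_def next_row_def)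
qed

text \<open>
  A line that is not horizontal meets two adjacent rows.
\<close>

lemma line_in_even_rows_is_horizontal:
  assumes "is_line k L" and "k \<ge> 2" and even_rows: "\<And>c r. (c, r) \<in> L \<Longrightarrow> even r"
  obtains c r where "L = (\<lambda>j. (c + j, r)) ` {..<k}"
proof -
  have not_rising: False if L: "L = (\<lambda>j. (f j, r + j)) ` {..<k}" for f :: "nat \<Rightarrow> nat" and r
  proof -
    have "(f 0, r) \<in> L" "(f 1, r + 1) \<in> L"
      unfolding L using \<open>k \<ge> 2\<close> by force+
    then have "even r" "even (r + 1)"
      using even_rows by blast+
    then show False by simp
  qed
  obtain c r where
    "L = (\<lambda>j. (c + j, r)) ` {..<k} \<or> L = (\<lambda>j. (c, r + j)) ` {..<k} \<or>
     L = (\<lambda>j. (c + j, r + j)) ` {..<k} \<or> L = (\<lambda>j. (c + (k - 1 - j), r + j)) ` {..<k}"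
    using assms(1) by (auto simp: is_line_def)
  then show thesis
    using that not_rising[of "\<lambda>_. c"] not_rising[of "\<lambda>j. c + j"]
      not_rising[of "\<lambda>j. c + (k - 1 - j)"] by metis
qed

section \<open>Who connects\<close>

text \<open>
  Each piece in P2's line has a piece of P1 directly below it, and the line is horizontal.
\<close>

lemma connects_row_below:
  assumes follows: "play_following k h w P2 take_even ms" and "k \<ge> 2"
    and "connects k ms P2"
  shows "connects k ms P1"
proof -
  note owner = parity_invariant(2)[OF follows]
  obtain L where "is_line k L" and L: "L \<subseteq> pieces ms P2"
    using assms(3) by (auto simp: connects_def)
  moreover have "even r" if "(c, r) \<in> L" for c r
    using that L by (auto simp: owner)
  ultimately obtain c r where row: "L = (\<lambda>j. (c + j, r)) ` {..<k}"
    using line_in_even_rows_is_horizontal \<open>k \<ge> 2\<close> by metis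
  have "(c + j, r) \<in> pieces ms P2" if "j < k" for j
    using that L row by auto
  then have "(c + j, r - 1) \<in> pieces ms P1" if "j < k" for j
    using that by (fastforce simp: owner elim: evenE)
  then have "(\<lambda>j. (c + j, r - 1)) ` {..<k} \<subseteq> pieces ms P1"
    by auto
  then show ?thesis
    unfolding connects_def is_line_def by blast
qed

text \<open>
  P2 can only complete a line with a move of P2. That move leaves P1's pieces unchanged, so by
  \<open>connects_row_below\<close> P1 had connected before it, and the move would have come after the end of
  the game.
\<close>

lemma P2_never_connects:
  assumes "play_following k h w P2 take_even ms" and "k \<ge> 2"
  shows "\<not> connects k ms P2"
proof (cases ms rule: rev_cases)
  case Nil
  moreover have "L \<noteq> {}" if "is_line k L" for L
    using that \<open>k \<ge> 2\<close> by (auto simp: is_line_def lessThan_empty_iff)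
  ultimately show ?thesis
    by (auto simp: connects_def pieces_def)
next
  case (snoc ms' c)
  show ?thesis
  proof
    assume P2_connects: "connects k ms P2"
    then have P1_connects: "connects k ms P1"
      using connects_row_below assms by blast
    have "\<exists>p. connects k ms' p"
    proof (cases "to_move ms'")
      case P1
      then show ?thesis
        using P2_connects snoc by (auto simp: connects_def pieces_snoc)
    next
      case P2
      then show ?thesis
        using P1_connects snoc by (auto simp: connects_def pieces_snoc)
    qed
    then show False
      using assms(1) snoc by (auto simp: play_following_snoc_iff game_over_def)
  qed
qed

text \<open>The bottom row, being odd, belongs to P1, and it contains a line because \<open>w \<ge> k\<close>.\<close>

lemma full_board_connects_P1:
  assumes follows: "play_following k h w P2 take_even ms" and "h > 0" and "w \<ge> k"
    and full: "\<not> (\<exists>c. legal_move h w ms c)"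
  shows "connects k ms P1"
proof -
  have "1 \<le> count_list ms c" if "c \<in> {1..w}" for c
    using full that \<open>h > 0\<close> by (force simp: legal_move_def next_row_def)
  then have "(\<lambda>j. (1 + j, 1)) ` {..<k} \<subseteq> pieces ms P1"
    using \<open>w \<ge> k\<close> by (auto simp: parity_invariant(2)[OF follows])
  then show ?thesis
    unfolding connects_def is_line_def by blast
qed

lemma take_even_inevitable:
  assumes "k \<ge> 2" and "h > 0" and "w \<ge> k"
  shows "inevitable k h w P2 take_even (\<lambda>ms. connects k ms P1 \<and> \<not> connects k ms P2)"
  unfolding inevitable_def
proof (intro conjI allI impI no_infinite_play_following)
  fix ms
  assume ms: "play_following k h w P2 take_even ms \<and> game_over k h w ms"
  then show "\<not> connects k ms P2"
    using P2_never_connects assms by blast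
  then have "connects k ms P1 \<or> \<not> (\<exists>c. legal_move h w ms c)"
    using ms by (metis game_over_def player.exhaust)
  then show "connects k ms P1"
    using full_board_connects_P1 ms assms by blast
qed

theorem corollary1:
  fixes k h w :: nat
  assumes "k \<ge> 2" and "h > 0" and "even h" and "w \<ge> k"
  shows "always_available k h w P2 take_even \<and>
         inevitable k h w P2 take_even (\<lambda>ms. connects k ms P1 \<and> \<not> connects k ms P2) \<and>
         guaranteed_win k h w P2"
proof (intro conjI)
  show available: "always_available k h w P2 take_even"
    using assms take_even_always_available by blast
  show inevitable: "inevitable k h w P2 take_even (\<lambda>ms. connects k ms P1 \<and> \<not> connects k ms P2)"
    using assms take_even_inevitable by blast
  obtain \<sigma> where "always_available k h w P2 (\<lambda>ms. {\<sigma> ms})"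
    and "\<And>Q. inevitable k h w P2 take_even Q \<Longrightarrow> inevitable k h w P2 (\<lambda>ms. {\<sigma> ms}) Q"
    using deterministic_refinement[OF available] by blast
  then show "guaranteed_win k h w P2"
    using inevitable by (auto simp: guaranteed_win_def wins_def)
qed

end
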